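(* Let $p,q,m$ be positive integers with $p\ge 2$, let $n=p+q+m$, and let $i$ be an integer with $1<i\le p$. The matrix $A=(C_p\oplus C_q\oplus C_m)+T(1,p+q,i,p+q+m)$ has finite multiplicative order if and only if $\gcd(p,q)$ and $\gcd(p,m)$ both divide $i-1$. In this case the order of $A$ is $\mathrm{lcm}(p,q,m)$ and $A$ is similar to the permutation matrix $C_p\oplus C_q\oplus C_m$.
   Context: $C_k$ is the $k\times k$ permutation matrix with $1$ in positions $(i+1,i)$ for $1\le i\le k-1$ and in position $(1,k)$ (companion matrix of $x^k-1$; $C_1=(1)$); $\oplus$ denotes matrix direct sum. $T(i_1,j_1,i_2,j_2)$ (with $i_1\ne i_2$, $j_1\ne j_2$) is the $n\times n$ matrix with $1$ in positions $(i_1,j_1),(i_2,j_2)$, $-1$ in positions $(i_1,j_2),(i_2,j_1)$, $0$ elsewhere. *)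

theory Defs
  imports "Jordan_Normal_Form.Matrix" "HOL-Algebra.Multiplicative_Group"
begin

text \<open>Matrices of the AFP library are indexed from 0; the definitions below shift indices so that
  they read exactly as with the usual 1-based positions.\<close>

(* 1 in positions (i+1,i) for 1 <= i <= k-1 and in position (1,k), counting from 1 *)
definition cyc_mat :: "nat \<Rightarrow> 'a :: ring_1 mat" where
  "cyc_mat k = mat k k (\<lambda>(r, c).
     if r + 1 = (c + 1) + 1 \<or> (r + 1 = 1 \<and> c + 1 = k) then 1 else 0)"

(* i1, j1, i2, j2 are 1-based positions *)
definition T_mat :: "nat \<Rightarrow> nat \<Rightarrow> nat \<Rightarrow> nat \<Rightarrow> nat \<Rightarrow> 'a :: ring_1 mat" where
  "T_mat n i1 j1 i2 j2 = mat n n (\<lambda>(r, c).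
     if (r + 1, c + 1) \<in> {(i1, j1), (i2, j2)} then 1
     else if (r + 1, c + 1) \<in> {(i1, j2), (i2, j1)} then - 1
     else 0)"

definition GL :: "nat \<Rightarrow> 'a :: ring_1 mat monoid" where
  "GL n = units_of (ring_mat TYPE('a) n ())"

(* group.ord is 0 on elements of infinite order, so finiteness is stated separately *)
definition has_finite_order :: "('a, 'b) monoid_scheme \<Rightarrow> 'a \<Rightarrow> bool" where
  "has_finite_order G x \<longleftrightarrow> x \<in> carrier G \<and> (\<exists>k::nat. k > 0 \<and> x [^]\<^bsub>G\<^esub> k = \<one>\<^bsub>G\<^esub>)"

end

theory Submission
  imports Defs "Jordan_Normal_Form.Determinant" "HOL-Number_Theory.Cong"
begin

text \<open>Write \<open>d = e\<^sub>0 - e\<^sub>a\<close> with \<open>a = i - 1\<close> (indices from 0). The matrix \<open>A\<close> rotates the first \<open>p\<close>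
  basis vectors, while \<open>A\<^sup>q x = x + d\<close> for \<open>x = e\<^bsub>p\<^esub>\<close> and \<open>A\<^sup>m y = y - d\<close> for \<open>y = e\<^bsub>p+q\<^esub>\<close>.
  If \<open>g = gcd p q\<close> does not divide \<open>a\<close>, then the functional summing the coordinates below \<open>p\<close>
  whose index is divisible by \<open>g\<close> takes the value \<open>k\<close> at \<open>A\<^bsup>qk\<^esup> x\<close>, so in characteristic 0
  no positive power of \<open>A\<close> is the identity; likewise for \<open>m\<close>. If \<open>g\<close> divides \<open>a\<close>, then
  \<open>q t = a\<close> modulo \<open>p\<close> for some \<open>t\<close>, and telescoping gives \<open>d = u - A\<^sup>q u\<close> for some \<open>u\<close> supported
  below \<open>p\<close>; hence \<open>x + u\<close> is fixed by \<open>A\<^sup>q\<close>. Doing the same for \<open>m\<close> yields a basis which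
  \<open>A\<close> permutes as \<open>P\<close> permutes the standard basis.\<close>

section \<open>Powers of matrices, as group elements and acting on vectors\<close>

lemma GL_pow:
  assumes "(A :: 'a :: ring_1 mat) \<in> carrier_mat n n"
  shows "A [^]\<^bsub>GL n\<^esub> (k :: nat) = A ^\<^sub>m k"
  using assms
  by (induction k) (auto simp: GL_def nat_pow_def units_of_def ring_mat_simps)

lemma group_GL: "group (GL n :: 'a :: comm_ring_1 mat monoid)"
  unfolding GL_def by (intro monoid.units_group ring.is_monoid ring_mat)

lemma one_GL: "\<one>\<^bsub>GL n\<^esub> = 1\<^sub>m n"
  by (simp add: GL_def units_of_def ring_mat_simps)

lemma mult_pow_mat_commute:
  assumes "(A :: 'a :: semiring_1 mat) \<in> carrier_mat n n"
  shows "A * A ^\<^sub>m k = A ^\<^sub>m k * A"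
proof (induction k)
  case (Suc k)
  have "A * (A ^\<^sub>m k * A) = (A * A ^\<^sub>m k) * A"
    using assms by (intro assoc_mult_mat[symmetric]) auto
  with Suc show ?case by simp
qed (use assms in auto)

text \<open>If \<open>A ^\<^sub>m Suc k\<close> is the identity, then \<open>A ^\<^sub>m k\<close>
  is a two-sided inverse of \<open>A\<close>. Invertibility is thus automatic, and finite order
  becomes a statement about matrix powers alone.\<close>

lemma has_finite_order_GL_iff:
  assumes A: "(A :: 'a :: comm_ring_1 mat) \<in> carrier_mat n n"
  shows "has_finite_order (GL n) A \<longleftrightarrow> (\<exists>k>0. A ^\<^sub>m k = 1\<^sub>m n)"
proof
  assume "has_finite_order (GL n) A"
  then show "\<exists>k>0. A ^\<^sub>m k = 1\<^sub>m n"
    using A unfolding has_finite_order_def by (auto simp: GL_pow one_GL)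
next
  assume "\<exists>k>0. A ^\<^sub>m k = 1\<^sub>m n"
  then obtain k where k: "A ^\<^sub>m (Suc k) = 1\<^sub>m n"
    by (metis gr0_implies_Suc)
  then have "A ^\<^sub>m k * A = 1\<^sub>m n" "A * A ^\<^sub>m k = 1\<^sub>m n"
    using mult_pow_mat_commute[OF A] by auto
  then have "A \<in> carrier (GL n)"
    using A by (auto simp: GL_def units_of_def Units_def ring_mat_simps intro!: bexI[of _ "A ^\<^sub>m k"])
  then show "has_finite_order (GL n) A"
    using k A unfolding has_finite_order_def by (auto simp: GL_pow one_GL simp del: pow_mat.simps)
qed

lemma mat_eqI_unit_vec:
  assumes A: "(A :: 'a :: semiring_1 mat) \<in> carrier_mat n n" and B: "B \<in> carrier_mat n n"
    and eq: "\<And>c. c < n \<Longrightarrow> A *\<^sub>v unit_vec n c = B *\<^sub>v unit_vec n c"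
  shows "A = B"
proof (rule eq_matI)
  fix r c assume "r < dim_row B" "c < dim_col B"
  then have r: "r < n" and c: "c < n" using B by auto
  have "row A r \<bullet> unit_vec n c = row B r \<bullet> unit_vec n c"
    using arg_cong[OF eq[OF c], of "\<lambda>v. v $ r"] A B r by simp
  moreover have "row A r \<in> carrier_vec n" "row B r \<in> carrier_vec n"
    using A B r by auto
  ultimately show "A $$ (r, c) = B $$ (r, c)"
    using A B r c by simp
qed (use A B in auto)

lemma pow_mat_add_vec:
  assumes A: "(A :: 'a :: semiring_1 mat) \<in> carrier_mat n n" and v: "v \<in> carrier_vec n"
  shows "A ^\<^sub>m (a + b) *\<^sub>v v = A ^\<^sub>m a *\<^sub>v (A ^\<^sub>m b *\<^sub>v v)"
  using v
proof (induction b arbitrary: v)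
  case (Suc b)
  have Av: "A *\<^sub>v v \<in> carrier_vec n" using A Suc by auto
  have "A ^\<^sub>m (a + Suc b) *\<^sub>v v = A ^\<^sub>m (a + b) *\<^sub>v (A *\<^sub>v v)"
    using A Suc.prems by (simp add: assoc_mult_mat_vec[of _ n n _ n])
  also have "\<dots> = A ^\<^sub>m a *\<^sub>v (A ^\<^sub>m b *\<^sub>v (A *\<^sub>v v))"
    using Suc Av by blast
  also have "\<dots> = A ^\<^sub>m a *\<^sub>v (A ^\<^sub>m (Suc b) *\<^sub>v v)"
    using A Suc.prems by (simp add: assoc_mult_mat_vec[of _ n n _ n])
  finally show ?case .
qed (use A in auto)

lemma pow_mat_Suc_vec:
  assumes "(A :: 'a :: semiring_1 mat) \<in> carrier_mat n n" and "v \<in> carrier_vec n"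
  shows "A ^\<^sub>m (Suc k) *\<^sub>v v = A *\<^sub>v (A ^\<^sub>m k *\<^sub>v v)"
  using pow_mat_add_vec[OF assms, of 1 k] assms by simp

text \<open>Assuming the step only for \<open>j < l\<close> lets an orbit be followed up to the last
  index of a cycle, where \<open>A\<close> may behave differently.\<close>

lemma pow_mat_unit_vec:
  assumes A: "(A :: 'a :: semiring_1 mat) \<in> carrier_mat n n"
    and step: "\<And>j. j < l \<Longrightarrow> A *\<^sub>v unit_vec n (f j) = unit_vec n (f (Suc j))"
    and "j \<le> l"
  shows "A ^\<^sub>m j *\<^sub>v unit_vec n (f 0) = unit_vec n (f j)"
  using \<open>j \<le> l\<close>
proof (induction j)
  case (Suc j)
  then show ?case using step pow_mat_Suc_vec[OF A, of "unit_vec n (f 0)" j] by simp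
qed (use A in simp)

section \<open>The index permutation of the three cyclic blocks\<close>

definition cycles3 :: "nat \<Rightarrow> nat \<Rightarrow> nat \<Rightarrow> nat \<Rightarrow> nat" where
  "cycles3 p q m c = (if c < p then Suc c mod p
     else if c < p + q then p + Suc (c - p) mod q
     else p + q + Suc (c - p - q) mod m)"

lemma cycles3_funpow:
  assumes "p > 0" "q > 0" "m > 0" "c < p + q + m"
  shows "(cycles3 p q m ^^ k) c = (if c < p then (c + k) mod p
     else if c < p + q then p + (c - p + k) mod q
     else p + q + (c - p - q + k) mod m)"
proof (induction k)
  case 0
  then show ?case using assms by auto
next
  case (Suc k)
  have "(c + k) mod p < p" "(c - p + k) mod q < q" "(c - p - q + k) mod m < m"
    using assms by auto
  with Suc show ?case by (auto simp: cycles3_def mod_Suc_eq)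
qed

lemma cycles3_less:
  assumes "p > 0" "q > 0" "m > 0" "c < p + q + m"
  shows "cycles3 p q m c < p + q + m"
  using assms mod_less_divisor[of p "Suc c"] mod_less_divisor[of q "Suc (c - p)"]
    mod_less_divisor[of m "Suc (c - p - q)"]
  unfolding cycles3_def by (auto intro: trans_less_add1 add_less_le_mono simp del: mod_less_divisor)

lemma cycles3_funpow_id_iff:
  assumes "p > 0" "q > 0" "m > 0"
  shows "(\<forall>c < p + q + m. (cycles3 p q m ^^ k) c = c) \<longleftrightarrow> lcm p (lcm q m) dvd k" (is "?L \<longleftrightarrow> ?R")
proof
  assume L: ?L
  \<comment> \<open>The first index of each cycle already detects divisibility by its
    length.\<close>
  have "k mod p = 0" using L[rule_format, of 0] assms by (simp add: cycles3_funpow)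
  moreover have "k mod q = 0" using L[rule_format, of p] assms by (simp add: cycles3_funpow)
  moreover have "k mod m = 0" using L[rule_format, of "p + q"] assms by (simp add: cycles3_funpow)
  ultimately show ?R by (auto simp: dvd_eq_mod_eq_0[symmetric])
next
  assume ?R
  then have "p dvd k" "q dvd k" "m dvd k"
    by (meson dvd_trans dvd_lcm1 dvd_lcm2)+
  then have "(a + k) mod p = a mod p" "(a + k) mod q = a mod q" "(a + k) mod m = a mod m" for a
    by auto
  then show ?L using assms
    by (auto simp: cycles3_funpow simp del: Nat.add_diff_assoc2 diff_diff_left)
qed

lemma cyc_mat_alt:
  "cyc_mat k = mat k k (\<lambda>(r, c). if r = Suc c mod k then 1 else 0 :: 'a :: ring_1)"
  unfolding cyc_mat_def by (rule cong_mat) (auto simp: mod_Suc)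

lemma diag_block_cyc_mat:
  assumes "p > 0" "q > 0" "m > 0"
  shows "diag_block_mat [cyc_mat p, cyc_mat q, cyc_mat m] =
    mat (p + q + m) (p + q + m) (\<lambda>(r, c). if r = cycles3 p q m c then 1 else 0 :: 'a :: ring_1)"
    (is "?P = ?Q")
proof (rule eq_matI)
  fix r c assume "r < dim_row ?Q" "c < dim_col ?Q"
  then have "r < p + q + m" "c < p + q + m" by auto
  \<comment> \<open>Of the three residues only the bounds matter: they determine which block the row
    \<open>r\<close> lies in.\<close>
  moreover obtain x y z where "x = Suc c mod p" "y = Suc (c - p) mod q" "z = Suc (c - p - q) mod m"
    by blast
  moreover from this have "x < p" "y < q" "z < m"
    using assms by auto
  ultimately show "?P $$ (r, c) = ?Q $$ (r, c)"
    by (auto simp: cyc_mat_alt Let_def cycles3_def simp flip: \<open>x = _\<close> \<open>y = _\<close> \<open>z = _\<close>)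
qed (auto simp: cyc_mat_alt Let_def)

lemma mat_unit_vec:
  assumes "c < n"
  shows "mat n n f *\<^sub>v unit_vec n c = vec n (\<lambda>r. f (r, c) :: 'a :: semiring_1)"
proof (rule eq_vecI)
  fix r assume "r < dim_vec (vec n (\<lambda>r. f (r, c)))"
  with assms show "(mat n n f *\<^sub>v unit_vec n c) $ r = vec n (\<lambda>r. f (r, c)) $ r"
    using scalar_prod_right_unit[of c n "row (mat n n f) r"] by simp
qed simp

section \<open>Necessity of the gcd conditions\<close>

lemma pow_rotated_unit_vec:
  assumes A: "(A :: 'a :: semiring_1 mat) \<in> carrier_mat n n"
    and rot: "\<And>j. j < p \<Longrightarrow> A *\<^sub>v unit_vec n j = unit_vec n (Suc j mod p)"
    and "j < p"
  shows "A ^\<^sub>m k *\<^sub>v unit_vec n j = unit_vec n ((j + k) mod p)"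
proof -
  have "A *\<^sub>v unit_vec n ((j + i) mod p) = unit_vec n ((j + Suc i) mod p)" for i
    using rot[of "(j + i) mod p"] \<open>j < p\<close> by (simp add: mod_Suc_eq)
  then show ?thesis
    using pow_mat_unit_vec[OF A, of k "\<lambda>i. (j + i) mod p" k] \<open>j < p\<close> by simp
qed

lemma pow_mat_eq_one_mult_vec:
  assumes A: "(A :: 'a :: semiring_1 mat) \<in> carrier_mat n n" and v: "v \<in> carrier_vec n"
    and "A ^\<^sub>m N = 1\<^sub>m n"
  shows "A ^\<^sub>m (l * N) *\<^sub>v v = v"
proof (induction l)
  case (Suc l)
  have "A ^\<^sub>m (l * N + N) *\<^sub>v v = v"
    using pow_mat_add_vec[OF A v, of "l * N" N] Suc assms by simp
  then show ?case by (simp add: add.commute)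
qed (use A v in simp)

text \<open>A linear functional that grows by \<open>b\<close> at each application of
  \<open>A ^\<^sub>m l\<close> excludes a return to the start. The parameters \<open>s\<close>,
  \<open>l\<close>, \<open>b\<close> cover both long cycles: \<open>p, q, 1\<close> and
  \<open>p + q, m, -1\<close>.\<close>

lemma pow_eq_one_imp_gcd_dvd:
  fixes A :: "'a :: field_char_0 mat"
  assumes A: "A \<in> carrier_mat n n"
    and rot: "\<And>j. j < p \<Longrightarrow> A *\<^sub>v unit_vec n j = unit_vec n (Suc j mod p)"
    and "p \<le> s" "s < n" "a < p"
    and ret: "A ^\<^sub>m l *\<^sub>v unit_vec n s = unit_vec n s + b \<cdot>\<^sub>v (unit_vec n 0 - unit_vec n a)"
    and "b \<noteq> 0"
    and "A ^\<^sub>m N = 1\<^sub>m n" "N > 0"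
  shows "gcd p l dvd a"
proof (rule ccontr)
  assume ndvd: "\<not> gcd p l dvd a"
  define y :: "'a vec" where "y = vec n (\<lambda>r. if r < p \<and> gcd p l dvd r then 1 else 0)"
  have y: "y \<in> carrier_vec n" by (simp add: y_def)
  \<comment> \<open>\<open>gcd p l\<close> divides both the shift \<open>l * k\<close> and the
    modulus \<open>p\<close>, so the rotation does not change whether an index is a multiple of
    it.\<close>
  have y_unit: "y \<bullet> unit_vec n ((j + l * k) mod p) = (if gcd p l dvd j then 1 else 0)" for j k
  proof -
    have "(j + l * k) mod p < p" using \<open>a < p\<close> by simp
    moreover have "gcd p l dvd (j + l * k) mod p \<longleftrightarrow> gcd p l dvd j"
      by (simp add: dvd_mod_iff dvd_add_left_iff)
    ultimately show ?thesis
      using \<open>p \<le> s\<close> \<open>s < n\<close> y by (simp add: y_def)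
  qed
  have "y \<bullet> (A ^\<^sub>m (l * k) *\<^sub>v unit_vec n s) = of_nat k * b" for k
  proof (induction k)
    case 0
    then show ?case using A y \<open>p \<le> s\<close> \<open>s < n\<close> by (simp add: y_def)
  next
    case (Suc k)
    define B where "B = A ^\<^sub>m (l * k)"
    have B: "B \<in> carrier_mat n n" using A by (simp add: B_def)
    have "A ^\<^sub>m (l * Suc k) *\<^sub>v unit_vec n s = B *\<^sub>v (A ^\<^sub>m l *\<^sub>v unit_vec n s)"
      using pow_mat_add_vec[OF A, of "unit_vec n s" "l * k" l] by (simp add: B_def add.commute)
    also have "\<dots> = B *\<^sub>v unit_vec n s + B *\<^sub>v (b \<cdot>\<^sub>v (unit_vec n 0 - unit_vec n a))"
      unfolding ret by (rule mult_add_distrib_mat_vec[OF B]) auto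
    also have "B *\<^sub>v (b \<cdot>\<^sub>v (unit_vec n 0 - unit_vec n a))
        = b \<cdot>\<^sub>v (B *\<^sub>v (unit_vec n 0 - unit_vec n a))"
      by (rule mult_mat_vec[OF B]) auto
    also have "B *\<^sub>v (unit_vec n 0 - unit_vec n a) = B *\<^sub>v unit_vec n 0 - B *\<^sub>v unit_vec n a"
      by (rule mult_minus_distrib_mat_vec[OF B]) auto
    also have "\<dots> = unit_vec n ((0 + l * k) mod p) - unit_vec n ((a + l * k) mod p)"
      using pow_rotated_unit_vec[OF A rot, of 0] pow_rotated_unit_vec[OF A rot, of a] \<open>a < p\<close>
      by (simp add: B_def)
    finally have "y \<bullet> (A ^\<^sub>m (l * Suc k) *\<^sub>v unit_vec n s)
        = y \<bullet> (B *\<^sub>v unit_vec n s) + b * (y \<bullet> unit_vec n ((0 + l * k) mod p)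
          - y \<bullet> unit_vec n ((a + l * k) mod p))"
      using y B by (simp add: scalar_prod_add_distrib[of _ n] scalar_prod_minus_distrib[of _ n])
    \<comment> \<open>Index 0 contributes 1 and index \<open>a\<close> contributes 0, so exactly
      \<open>b\<close> is added.\<close>
    also have "\<dots> = of_nat (Suc k) * b"
      using Suc ndvd unfolding y_unit B_def by (simp add: algebra_simps)
    finally show ?case .
  qed
  \<comment> \<open>After \<open>l * N\<close> steps the vector is back at the start, where the
    functional is 0 because \<open>p \<le> s\<close>; in characteristic 0 this contradicts the value
    \<open>of_nat N * b\<close>.\<close>
  from this[of N] have "y $ s = of_nat N * b"
    using pow_mat_eq_one_mult_vec[OF A _ \<open>A ^\<^sub>m N = 1\<^sub>m n\<close>, of "unit_vec n s" l] y \<open>s < n\<close> by simp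
  then show False
    using \<open>p \<le> s\<close> \<open>s < n\<close> \<open>b \<noteq> 0\<close> \<open>N > 0\<close> by (simp add: y_def)
qed

section \<open>Solving for the correcting vectors, and similarity\<close>

text \<open>Bezout solves the congruence for \<open>gcd l p\<close>, and scaling by the cofactor of
  \<open>a\<close> gives \<open>a\<close> itself. For \<open>l = 0\<close> the gcd is
  \<open>p\<close>, which is 0 modulo \<open>p\<close>.\<close>

lemma ex_mult_mod_eq:
  fixes p l a :: nat
  assumes "gcd p l dvd a" "a < p"
  obtains t where "l * t mod p = a"
proof -
  obtain x where "[l * x = gcd l p] (mod p)"
    using cong_solve_nat[of l p] \<open>a < p\<close> by (cases "l = 0") (auto simp: cong_def)
  moreover obtain c where "a = gcd l p * c"
    using assms by (auto simp: gcd.commute)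
  ultimately have "[l * x * c = a] (mod p)"
    using cong_scalar_right by blast
  then have "l * (x * c) mod p = a"
    using \<open>a < p\<close> by (simp add: cong_def mult.assoc)
  then show ?thesis by (rule that)
qed

text \<open>The solution is \<open>b\<close> times the sum of the unit vectors at
  \<open>l * k mod p\<close> for \<open>k < t\<close>, where \<open>l * t mod p = a\<close>:
  \<open>A ^\<^sub>m l\<close> moves each summand to the next, so the difference telescopes. If
  \<open>A ^\<^sub>m l\<close> sends \<open>x\<close> to \<open>x\<close> plus \<open>b\<close>
  times the difference of unit vectors, it then fixes \<open>x + u\<close>.\<close>

lemma ex_conjugating_vec:
  fixes A :: "'a :: field mat"
  assumes A: "A \<in> carrier_mat n n"
    and rot: "\<And>j. j < p \<Longrightarrow> A *\<^sub>v unit_vec n j = unit_vec n (Suc j mod p)"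
    and "p \<le> n" "a < p" "gcd p l dvd a"
  obtains u where "u \<in> carrier_vec n" "\<And>r. p \<le> r \<Longrightarrow> r < n \<Longrightarrow> u $ r = 0"
    "b \<cdot>\<^sub>v (unit_vec n 0 - unit_vec n a) + A ^\<^sub>m l *\<^sub>v u = u"
proof -
  \<comment> \<open>Replacing \<open>a\<close> by the moving endpoint \<open>l * t mod p\<close>
    allows induction on \<open>t\<close>, from the empty sum and adding one unit vector at a
    time.\<close>
  have "\<exists>u \<in> carrier_vec n. (\<forall>r. p \<le> r \<longrightarrow> r < n \<longrightarrow> u $ r = 0) \<and>
    b \<cdot>\<^sub>v (unit_vec n 0 - unit_vec n (l * t mod p)) + A ^\<^sub>m l *\<^sub>v u = u" for t
  proof (induction t)
    case 0
    show ?case using A by (intro bexI[of _ "0\<^sub>v n"]) auto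
  next
    case (Suc t)
    then obtain u where u: "u \<in> carrier_vec n" "\<forall>r. p \<le> r \<longrightarrow> r < n \<longrightarrow> u $ r = 0"
      "b \<cdot>\<^sub>v (unit_vec n 0 - unit_vec n (l * t mod p)) + A ^\<^sub>m l *\<^sub>v u = u"
      by blast
    define j where "j = l * t mod p"
    have j: "j < p" using \<open>a < p\<close> by (simp add: j_def)
    have Al: "A ^\<^sub>m l \<in> carrier_mat n n" using A by simp
    have "A ^\<^sub>m l *\<^sub>v (b \<cdot>\<^sub>v unit_vec n j) = b \<cdot>\<^sub>v unit_vec n ((j + l) mod p)"
      using pow_rotated_unit_vec[OF A rot j] by (simp add: mult_mat_vec[OF Al])
    also have "(j + l) mod p = l * Suc t mod p"
      by (simp add: j_def mod_simps add.commute)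
    finally have "A ^\<^sub>m l *\<^sub>v (u + b \<cdot>\<^sub>v unit_vec n j)
        = A ^\<^sub>m l *\<^sub>v u + b \<cdot>\<^sub>v unit_vec n (l * Suc t mod p)"
      using u Al by (simp add: mult_add_distrib_mat_vec)
    moreover have "A ^\<^sub>m l *\<^sub>v u \<in> carrier_vec n" using u Al by auto
    moreover have "b * (unit_vec n 0 $ r - unit_vec n j $ r) + (A ^\<^sub>m l *\<^sub>v u) $ r = u $ r"
      if "r < n" for r
      using arg_cong[OF u(3), of "\<lambda>v. v $ r"] that A unfolding j_def[symmetric]
      by (simp del: index_mult_mat_vec index_unit_vec(1,2))
    ultimately have "b \<cdot>\<^sub>v (unit_vec n 0 - unit_vec n (l * Suc t mod p))
        + A ^\<^sub>m l *\<^sub>v (u + b \<cdot>\<^sub>v unit_vec n j) = u + b \<cdot>\<^sub>v unit_vec n j"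
      using u(1) A
      by (intro eq_vecI) (auto simp: algebra_simps simp del: index_mult_mat_vec index_unit_vec(1,2))
    then show ?case
      using u j \<open>p \<le> n\<close> by (intro bexI[of _ "u + b \<cdot>\<^sub>v unit_vec n j"]) auto
  qed
  moreover obtain t where "l * t mod p = a"
    using ex_mult_mod_eq[OF \<open>gcd p l dvd a\<close> \<open>a < p\<close>] .
  ultimately show ?thesis using that by metis
qed

text \<open>\<open>A\<close> permutes the first \<open>p\<close> unit vectors, so their span is
  invariant under its powers.\<close>

lemma pow_rotated_support:
  fixes A :: "'a :: semiring_1 mat"
  assumes A: "A \<in> carrier_mat n n"
    and rot: "\<And>j. j < p \<Longrightarrow> A *\<^sub>v unit_vec n j = unit_vec n (Suc j mod p)"
    and v: "v \<in> carrier_vec n" "\<And>r. p \<le> r \<Longrightarrow> r < n \<Longrightarrow> v $ r = 0"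
    and r: "p \<le> r" "r < n"
  shows "(A ^\<^sub>m k *\<^sub>v v) $ r = 0"
  using r
proof (induction k arbitrary: r)
  case 0
  then show ?case using A v by simp
next
  case (Suc k)
  have "A $$ (r, j) = 0" if "j < p" for j
  proof -
    have "row A r \<in> carrier_vec n" using A Suc by auto
    then have "A $$ (r, j) = (A *\<^sub>v unit_vec n j) $ r"
      using A Suc that by simp
    also have "\<dots> = 0"
      using rot[OF that] Suc.prems mod_less_divisor[of p "Suc j"] that
      by (simp del: mod_less_divisor)
    finally show ?thesis .
  qed
  moreover have "(A ^\<^sub>m k *\<^sub>v v) $ j = 0" if "\<not> j < p" "j < n" for j
    using Suc.IH that by simp
  \<comment> \<open>One factor always vanishes: the matrix entry for \<open>j < p\<close>, the
    vector entry otherwise.\<close>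
  ultimately have "A $$ (r, j) * (A ^\<^sub>m k *\<^sub>v v) $ j = 0" if "j < n" for j
    using that by (cases "j < p") auto
  then have "row A r \<bullet> (A ^\<^sub>m k *\<^sub>v v) = 0"
    using A Suc.prems by (simp add: scalar_prod_def sum.neutral del: index_mult_mat_vec)
  then show ?case
    unfolding pow_mat_Suc_vec[OF A v(1)] using A Suc.prems by (simp add: index_mult_mat_vec(1))
qed

text \<open>The matrix with columns \<open>e\<^sub>c + w c\<close> is upper unitriangular and conjugates \<open>B\<close> to \<open>A\<close>.\<close>

lemma similar_mat_if_coboundary:
  fixes A B :: "'a :: field mat"
  assumes A: "A \<in> carrier_mat n n" and B: "B \<in> carrier_mat n n"
    and \<sigma>: "\<And>c. c < n \<Longrightarrow> \<sigma> c < n" "\<And>c. c < n \<Longrightarrow> B *\<^sub>v unit_vec n c = unit_vec n (\<sigma> c)"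
    and t: "\<And>c. c < n \<Longrightarrow> t c \<in> carrier_vec n" "\<And>c. c < n \<Longrightarrow> A *\<^sub>v unit_vec n c = unit_vec n (\<sigma> c) + t c"
    and w: "\<And>c. c < n \<Longrightarrow> w c \<in> carrier_vec n" "\<And>c. c < p \<Longrightarrow> w c = 0\<^sub>v n"
      "\<And>c r. c < n \<Longrightarrow> p \<le> r \<Longrightarrow> r < n \<Longrightarrow> w c $ r = 0"
    and cobound: "\<And>c. c < n \<Longrightarrow> t c + A *\<^sub>v w c = w (\<sigma> c)"
  shows "similar_mat A B"
proof -
  define S where "S = mat n n (\<lambda>(r, c). (unit_vec n c + w c) $ r)"
  have S: "S \<in> carrier_mat n n" by (simp add: S_def)
  have S_unit: "S *\<^sub>v unit_vec n c = unit_vec n c + w c" if "c < n" for c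
    unfolding S_def mat_unit_vec[OF that] using w(1)[OF that] by (intro eq_vecI) auto
  \<comment> \<open>On and below the diagonal \<open>w\<close> contributes nothing: either
    \<open>c < p\<close> and \<open>w c\<close> is zero, or \<open>p \<le> c \<le> r\<close> and row
    \<open>r\<close> is outside its support.\<close>
  have S_index: "S $$ (r, c) = (if r = c then 1 else 0)" if "r < n" "c < n" "c \<le> r" for r c
    using that w(1)[of c] w(2)[of c] w(3)[of c r] by (cases "c < p") (auto simp: S_def)
  have "upper_triangular S"
    using S S_index by (auto intro!: upper_triangularI)
  moreover have "diag_mat S = map (\<lambda>_. 1) [0..<n]"
    using S S_index by (auto simp: diag_mat_def)
  ultimately have "det S = 1"
    using det_upper_triangular[OF _ S] by (simp add: map_replicate_const)
  then have "S \<in> Units (ring_mat TYPE('a) n ())"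
    using det_non_zero_imp_unit[OF S] by simp
  then obtain S' where S': "S' \<in> carrier_mat n n" "S * S' = 1\<^sub>m n" "S' * S = 1\<^sub>m n"
    by (auto simp: Units_def ring_mat_simps)
  have "A * S = S * B"
  proof (rule mat_eqI_unit_vec)
    fix c assume c: "c < n"
    have "A * S *\<^sub>v unit_vec n c = A *\<^sub>v (unit_vec n c + w c)"
      using A S c S_unit by (simp add: assoc_mult_mat_vec[of _ n n _ n])
    also have "\<dots> = (unit_vec n (\<sigma> c) + t c) + A *\<^sub>v w c"
      using mult_add_distrib_mat_vec[OF A _ w(1)] c t(2) by simp
    \<comment> \<open>After this regrouping \<open>cobound\<close> turns the bracket into
      \<open>w (\<sigma> c)\<close>, which gives the column of \<open>S\<close> at
      \<open>\<sigma> c\<close>.\<close>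
    also have "\<dots> = unit_vec n (\<sigma> c) + (t c + A *\<^sub>v w c)"
      by (rule assoc_add_vec[of _ n]) (use A c t(1) w(1) in auto)
    also have "\<dots> = S *\<^sub>v unit_vec n (\<sigma> c)"
      using c S_unit[of "\<sigma> c"] \<sigma>(1) cobound by simp
    also have "\<dots> = S * B *\<^sub>v unit_vec n c"
      using B S c \<sigma>(2) by (simp add: assoc_mult_mat_vec[of _ n n _ n])
    finally show "A * S *\<^sub>v unit_vec n c = S * B *\<^sub>v unit_vec n c" .
  qed (use A B S in auto)
  then have "S * B * S' = A * (S * S')"
    using assoc_mult_mat[OF A S S'(1)] by simp
  then show ?thesis
    using A B S S' by (intro similar_matI[of _ _ S S' n]) auto
qed

section \<open>The perturbed permutation matrix and its order\<close>

theorem theorem4p9: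
  fixes p q m n i :: nat
    and P A :: "'a :: field_char_0 mat"
  assumes "p \<ge> 2" and "q \<ge> 1" and "m \<ge> 1"
    and "n = p + q + m"
    and "1 < i" and "i \<le> p"
    and "P = diag_block_mat [cyc_mat p, cyc_mat q, cyc_mat m]"
    and "A = P + T_mat n 1 (p + q) i (p + q + m)"
  shows "(has_finite_order (GL n) A \<longleftrightarrow> gcd p q dvd i - 1 \<and> gcd p m dvd i - 1)
    \<and> (has_finite_order (GL n) A \<longrightarrow>
         group.ord (GL n) A = lcm p (lcm q m) \<and> similar_mat A P)"
proof -
  define a where "a = i - 1"
  have a: "0 < a" "a < p" "i = Suc a" using assms by (auto simp: a_def)
  have pos: "p > 0" "q > 0" "m > 0" using assms by auto
  define \<sigma> where "\<sigma> = cycles3 p q m"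
  define d :: "'a vec" where "d = unit_vec n 0 - unit_vec n a"
  \<comment> \<open>\<open>t c\<close> is column \<open>c\<close> of the perturbation, nonzero only
    at the last indices of the second and third cycles. The factor 1 gives both cases the common
    shape \<open>b \<cdot>\<^sub>v d\<close>.\<close>
  define t where "t c = (if c = p + q - 1 then 1 \<cdot>\<^sub>v d
    else if c = n - 1 then (-1) \<cdot>\<^sub>v d else 0\<^sub>v n)" for c
  have d: "d \<in> carrier_vec n" by (simp add: d_def)
  then have t: "t c \<in> carrier_vec n" for c by (simp add: t_def)
  have \<sigma>: "\<sigma> c < n" if "c < n" for c
    using cycles3_less[OF pos, of c] that \<open>n = _\<close> by (simp add: \<sigma>_def)
  have P_eq: "P = mat n n (\<lambda>(r, c). if r = \<sigma> c then 1 else 0)"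
    using diag_block_cyc_mat[OF pos] assms by (simp add: \<sigma>_def)
  then have P: "P \<in> carrier_mat n n" by simp
  have T: "(T_mat n 1 (p + q) i (p + q + m) :: 'a mat) \<in> carrier_mat n n"
    by (simp add: T_mat_def)
  have A: "A \<in> carrier_mat n n" unfolding \<open>A = _\<close> using T by (rule add_carrier_mat)
  have P_unit: "P *\<^sub>v unit_vec n c = unit_vec n (\<sigma> c)" if "c < n" for c
    unfolding P_eq mat_unit_vec[OF that] using \<sigma>[OF that] by (intro eq_vecI) auto
  have T_unit: "T_mat n 1 (p + q) i (p + q + m) *\<^sub>v unit_vec n c = t c" if "c < n" for c
    unfolding T_mat_def mat_unit_vec[OF that]
    using that a pos \<open>n = _\<close> by (intro eq_vecI) (auto simp: t_def d_def)
  have A_unit: "A *\<^sub>v unit_vec n c = unit_vec n (\<sigma> c) + t c" if "c < n" for c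
    using add_mult_distrib_mat_vec[OF P T, of "unit_vec n c"] P_unit[OF that] T_unit[OF that]
      \<open>A = _\<close> by simp
  have rot: "A *\<^sub>v unit_vec n j = unit_vec n (Suc j mod p)" if "j < p" for j
  proof -
    have "j < n" "t j = 0\<^sub>v n" using that pos \<open>n = _\<close> by (auto simp: t_def)
    then show ?thesis using A_unit[of j] that by (simp add: \<sigma>_def cycles3_def)
  qed

  \<comment> \<open>The triples are start, length and sign of a long cycle. One turn meets a
    perturbed column only at its last step, so it adds \<open>d\<close> once with that sign.\<close>
  have ret: "A ^\<^sub>m l *\<^sub>v unit_vec n s = unit_vec n s + b \<cdot>\<^sub>v (unit_vec n 0 - unit_vec n a)"
    if "(s, l, b) \<in> {(p, q, 1), (p + q, m, -1)}" for s l b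
  proof -
    have l: "l > 0" "s + l \<le> n" "s \<ge> p" using that pos \<open>n = _\<close> by auto
    have "A *\<^sub>v unit_vec n (s + j) = unit_vec n (s + Suc j)" if "j < l - 1" for j
    proof -
      have "s + j < n" "s + j \<noteq> n - 1" using that l by auto
      moreover have "s + j \<noteq> p + q - 1"
        using that pos \<open>_ \<in> {_, _}\<close> by auto
      moreover have "\<sigma> (s + j) = s + Suc j"
        using that \<open>_ \<in> {_, _}\<close> by (auto simp: \<sigma>_def cycles3_def)
      ultimately show ?thesis using A_unit[of "s + j"] by (simp add: t_def)
    qed
    then have "A ^\<^sub>m (l - 1) *\<^sub>v unit_vec n (s + 0) = unit_vec n (s + (l - 1))"
      by (intro pow_mat_unit_vec[OF A, of "l - 1"]) auto
    then have "A ^\<^sub>m l *\<^sub>v unit_vec n s = A *\<^sub>v unit_vec n (s + (l - 1))"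
      using pow_mat_Suc_vec[OF A, of "unit_vec n s" "l - 1"] l by simp
    also have "\<dots> = unit_vec n s + b \<cdot>\<^sub>v d"
    proof -
      have "s + (l - 1) < n" using l by simp
      moreover have "\<sigma> (s + (l - 1)) = s"
        using that pos by (auto simp: \<sigma>_def cycles3_def)
      moreover have "t (s + (l - 1)) = b \<cdot>\<^sub>v d"
        using that pos \<open>n = _\<close> by (auto simp: t_def)
      ultimately show ?thesis using A_unit[of "s + (l - 1)"] by simp
    qed
    finally show ?thesis by (simp add: d_def)
  qed

  \<comment> \<open>Finite order forces divisibility\<close>
  have dvd: "gcd p q dvd a \<and> gcd p m dvd a" if "has_finite_order (GL n) A"
  proof -
    from that obtain N where N: "A ^\<^sub>m N = 1\<^sub>m n" "N > 0"
      using has_finite_order_GL_iff[OF A] by auto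
    show ?thesis
      using pow_eq_one_imp_gcd_dvd[OF A rot _ _ \<open>a < p\<close> ret[of p q 1] _ N]
        pow_eq_one_imp_gcd_dvd[OF A rot _ _ \<open>a < p\<close> ret[of "p + q" m "-1"] _ N] pos \<open>n = _\<close>
      by simp
  qed

  \<comment> \<open>Divisibility gives similarity\<close>
  have sim: "similar_mat A P" if dvds: "gcd p q dvd a" "gcd p m dvd a"
  proof -
    have "p \<le> n" using \<open>n = _\<close> by simp
    obtain u where u: "u \<in> carrier_vec n" "\<And>r. p \<le> r \<Longrightarrow> r < n \<Longrightarrow> u $ r = 0"
      "1 \<cdot>\<^sub>v d + A ^\<^sub>m q *\<^sub>v u = u"
      unfolding d_def
      using ex_conjugating_vec[OF A rot \<open>p \<le> n\<close> \<open>a < p\<close> dvds(1), where b = "1"] by blast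
    obtain v where v: "v \<in> carrier_vec n" "\<And>r. p \<le> r \<Longrightarrow> r < n \<Longrightarrow> v $ r = 0"
      "(-1) \<cdot>\<^sub>v d + A ^\<^sub>m m *\<^sub>v v = v"
      unfolding d_def
      using ex_conjugating_vec[OF A rot \<open>p \<le> n\<close> \<open>a < p\<close> dvds(2), where b = "-1"] by blast
    \<comment> \<open>The corrections \<open>u\<close> and \<open>v\<close> belong to the first
      indices \<open>p\<close> and \<open>p + q\<close>; powers of \<open>A\<close> carry them along
      their cycles.\<close>
    define w where "w c = (if c < p then 0\<^sub>v n else if c < p + q then A ^\<^sub>m (c - p) *\<^sub>v u
      else A ^\<^sub>m (c - p - q) *\<^sub>v v)" for c
    have carr: "A ^\<^sub>m k *\<^sub>v u \<in> carrier_vec n" "A ^\<^sub>m k *\<^sub>v v \<in> carrier_vec n" for k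
      using A u(1) v(1) by (auto intro!: mult_mat_vec_carrier[of _ n n])
    show ?thesis
    proof (rule similar_mat_if_coboundary[OF A P \<sigma> P_unit t A_unit])
      show "w c \<in> carrier_vec n" for c
        using carr by (simp add: w_def)
      show "w c = 0\<^sub>v n" if "c < p" for c using that by (simp add: w_def)
      show "w c $ r = 0" if "c < n" "p \<le> r" "r < n" for c r
        using that pow_rotated_support[OF A rot u(1,2)] pow_rotated_support[OF A rot v(1,2)]
        by (simp add: w_def)
      show "t c + A *\<^sub>v w c = w (\<sigma> c)" if "c < n" for c
      proof -
        have Aw: "A *\<^sub>v (A ^\<^sub>m k *\<^sub>v u) = A ^\<^sub>m Suc k *\<^sub>v u" "A *\<^sub>v (A ^\<^sub>m k *\<^sub>v v) = A ^\<^sub>m Suc k *\<^sub>v v" for k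
          using pow_mat_Suc_vec[OF A] u(1) v(1) by metis+
        \<comment> \<open>Inside a long cycle the equation is the construction of \<open>w\<close>,
          and in the first block all terms vanish. Only at the last indices, cases 3 and 5, must the
          cycle close up; there \<open>u(3)\<close> and \<open>v(3)\<close> apply.\<close>
        consider "c < p" | "p \<le> c" "Suc c < p + q" | "Suc c = p + q"
          | "p + q \<le> c" "Suc c < n" | "Suc c = n"
          using \<open>c < n\<close> by linarith
        then show ?thesis
        proof cases
          case 1
          then have "t c = 0\<^sub>v n" "w c = 0\<^sub>v n" using pos \<open>n = _\<close> by (auto simp: t_def w_def)
          moreover have "\<sigma> c < p" using 1 by (simp add: \<sigma>_def cycles3_def)
          then have "w (\<sigma> c) = 0\<^sub>v n" by (simp add: w_def)
          moreover have "A *\<^sub>v 0\<^sub>v n = 0\<^sub>v n" using A by (intro eq_vecI) auto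
          ultimately show ?thesis by simp
        next
          case 2
          then have "t c = 0\<^sub>v n" "\<sigma> c = Suc c" using pos \<open>n = _\<close>
            by (auto simp: t_def \<sigma>_def cycles3_def)
          moreover have "w c = A ^\<^sub>m (c - p) *\<^sub>v u" "w (Suc c) = A ^\<^sub>m Suc (c - p) *\<^sub>v u"
            using 2 by (simp_all add: w_def Suc_diff_le del: pow_mat.simps)
          ultimately show ?thesis using Aw(1)[of "c - p"] carr(1)[of "Suc (c - p)"] by simp
        next
          case 3
          then have "t c = 1 \<cdot>\<^sub>v d" by (auto simp: t_def)
          moreover have "Suc (c - p) = q" "\<not> c < p" "c < p + q" using 3 pos by auto
          then have "\<sigma> c = p" by (simp add: \<sigma>_def cycles3_def)
          moreover have "c - p = q - 1" "\<not> c < p" "c < p + q" using 3 pos by auto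
          then have "w c = A ^\<^sub>m (q - 1) *\<^sub>v u" by (simp add: w_def)
          moreover have "w p = u" using A u(1) pos by (simp add: w_def)
          ultimately show ?thesis using Aw(1)[of "q - 1"] u(3) pos by (simp del: pow_mat.simps)
        next
          case 4
          then have "t c = 0\<^sub>v n" "\<sigma> c = Suc c" using pos \<open>n = _\<close>
            by (auto simp: t_def \<sigma>_def cycles3_def)
          moreover have "w c = A ^\<^sub>m (c - p - q) *\<^sub>v v" using 4 by (simp add: w_def)
          moreover have "Suc c - p - q = Suc (c - p - q)" "\<not> Suc c < p" "\<not> Suc c < p + q"
            using 4 by auto
          then have "w (Suc c) = A ^\<^sub>m Suc (c - p - q) *\<^sub>v v"
            unfolding w_def by presburger
          ultimately show ?thesis using Aw(2)[of "c - p - q"] carr(2)[of "Suc (c - p - q)"] by simp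
        next
          case 5
          then have "t c = (-1) \<cdot>\<^sub>v d" using pos \<open>n = _\<close> by (auto simp: t_def)
          moreover have "Suc (c - p - q) = m" "\<not> c < p" "\<not> c < p + q" using 5 pos \<open>n = _\<close> by auto
          then have "\<sigma> c = p + q"
            unfolding \<sigma>_def cycles3_def by simp
          moreover have "c - p - q = m - 1" "\<not> c < p" "\<not> c < p + q" using 5 pos \<open>n = _\<close> by auto
          then have "w c = A ^\<^sub>m (m - 1) *\<^sub>v v" by (simp add: w_def)
          moreover have "w (p + q) = v" using A v(1) by (simp add: w_def)
          ultimately show ?thesis using Aw(2)[of "m - 1"] v(3) pos by (simp del: pow_mat.simps)
        qed
      qed
    qed
  qed

  \<comment> \<open>The orders of \<open>P\<close> and \<open>A\<close>\<close>
  have P_pow: "P ^\<^sub>m k = 1\<^sub>m n \<longleftrightarrow> lcm p (lcm q m) dvd k" for k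
  proof -
    have iter: "(\<sigma> ^^ k) c < n" if "c < n" for c k
      using that \<sigma> by (induction k) auto
    have "P ^\<^sub>m k *\<^sub>v unit_vec n c = unit_vec n ((\<sigma> ^^ k) c)" if "c < n" for c
      using pow_mat_unit_vec[OF P, of k "\<lambda>k. (\<sigma> ^^ k) c" k] P_unit iter[OF that] by simp
    then have "P ^\<^sub>m k = 1\<^sub>m n \<longleftrightarrow> (\<forall>c<n. unit_vec n ((\<sigma> ^^ k) c) = (unit_vec n c :: 'a vec))"
      using mat_eqI_unit_vec[of "P ^\<^sub>m k" n "1\<^sub>m n"] P by (metis one_carrier_mat one_mult_mat_vec pow_carrier_mat unit_vec_carrier)
    \<comment> \<open>Unit vectors determine their index only below \<open>n\<close>, beyond which
      they are all zero; \<open>iter\<close> keeps the orbit in range.\<close>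
    also have "\<dots> \<longleftrightarrow> (\<forall>c<n. (\<sigma> ^^ k) c = c)"
      using iter unit_vec_eq by metis
    also have "\<dots> \<longleftrightarrow> lcm p (lcm q m) dvd k"
      using cycles3_funpow_id_iff[OF pos] \<open>n = _\<close> by (simp add: \<sigma>_def)
    finally show ?thesis .
  qed

  have A_pow: "A ^\<^sub>m k = 1\<^sub>m n \<longleftrightarrow> lcm p (lcm q m) dvd k" if "similar_mat A P" for k
  proof -
    from that obtain S S' where wit: "similar_mat_wit A P S S'"
      unfolding similar_mat_def by blast
    \<comment> \<open>Conjugation in both directions shows that \<open>A\<close> and
      \<open>P\<close> have the same exponents giving the identity.\<close>
    show ?thesis
      using similar_mat_wit_pow_id[OF wit, of k] similar_mat_wit_pow_id[OF similar_mat_wit_sym[OF wit], of k]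
        similar_mat_witD2[OF A wit] P_pow[of k] by auto
  qed
  have fin: "has_finite_order (GL n) A" if "similar_mat A P"
    using A_pow[OF that] pos has_finite_order_GL_iff[OF A] by (metis dvd_refl lcm_pos_nat)
  have ord: "group.ord (GL n) A = lcm p (lcm q m)" if "similar_mat A P"
  proof -
    interpret G: group "GL n :: 'a mat monoid" by (rule group_GL)
    have "A \<in> carrier (GL n)" using fin[OF that] by (simp add: has_finite_order_def)
    \<comment> \<open>The order and the lcm have the same multiples, hence divide each
      other.\<close>
    then have "G.ord A dvd k \<longleftrightarrow> lcm p (lcm q m) dvd k" for k
      using G.pow_eq_id[of A k] A_pow[OF that, of k] A by (simp add: GL_pow one_GL)
    then show ?thesis by (meson dvd_antisym dvd_refl)
  qed
  \<comment> \<open>The circle closes: finite order gives divisibility, which gives similarity,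
    which gives finite order and its value.\<close>
  show ?thesis
    using dvd sim fin ord unfolding a_def by blast
qed

end
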